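(* Let $V$ be an infinite dimensional complex vector space and let $\mathfrak{g}$ be the quadratic Lie algebra of finite rank linear operators of $V$, with the commutator bracket and invariant bilinear form $B(X,Y)=\mathrm{Tr}(XY)$. Then the natural map $\Theta^*\colon H^0_c(\mathfrak{g})\to H^1(\mathfrak{g})$ is not onto.
   Context: $\mathrm{Tr}$ is the usual trace of finite rank operators; $B$ is symmetric, invariant and non degenerate on $\mathfrak{g}$. $\bigwedge^p\mathfrak{g}$ is the space of all skew symmetric $p$-linear forms on $\mathfrak{g}$, and $H^*(\mathfrak{g})$ is the cohomology with trivial coefficients, i.e. of $\bigwedge\mathfrak{g}$ with $\partial\Omega(Y_1,\dots,Y_{p+1})=\sum_{i<j}(-1)^{i+j}\Omega([Y_i,Y_j],Y_1,\dots,\widehat{Y_i},\dots,\widehat{Y_j},\dots,Y_{p+1})$. $\mathcal{M}_a^0(\mathfrak{g})=\mathfrak{g}$, and for $k\ge1$, $\mathcal{M}_a^k(\mathfrak{g})$ is the space of skew symmetric $k$-linear maps $\mathfrak{g}^k\to\mathfrak{g}$; $d$ is the Chevalley differential of $\mathfrak{g}$ with coefficients in the adjoint representation on $\mathcal{M}_a(\mathfrak{g})=\sum_k\mathcal{M}_a^k(\mathfrak{g})$. For $C\in\mathcal{M}_a^k(\mathfrak{g})$, $\hat C(Y_1,\dots,Y_{k+1})=B(C(Y_1,\dots,Y_k),Y_{k+1})$ ($\hat C(Y)=B(C,Y)$ if $k=0$). $C$ is a cyclic cochain if $\hat C(Y_1,\dots,Y_{k+1})=(-1)^k\hat C(Y_{k+1},Y_1,\dots,Y_k)$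 for all $Y_i$, equivalently if $\hat C$ is skew symmetric. Cyclic cochains form a subcomplex $\mathcal{C}_c(\mathfrak{g})$ of $(\mathcal{M}_a(\mathfrak{g}),d)$, whose cohomology is the cyclic cohomology $H_c^*(\mathfrak{g})$. The map $\Theta(C)=\hat C$ from $\mathcal{C}_c(\mathfrak{g})$ to $\bigwedge_+\mathfrak{g}=\sum_{p\ge1}\bigwedge^p\mathfrak{g}$ is a homomorphism of complexes and induces $\Theta^*\colon H_c^k(\mathfrak{g})\to H^{k+1}(\mathfrak{g})$. *)

theory Defs
  imports Complex_Main "HOL-Library.Function_Algebras"
begin

section \<open>Complex Lie algebras with a bilinear form\<close>

text \<open>
  The Lie algebra lives on a subset \<open>lcarrier\<close> of a type of class \<open>ab_group_add\<close>, which supplies the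
  addition. For a Lie algebra of operators that type is a function type, and the addition is the
  pointwise one of \<^theory>\<open>HOL-Library.Function_Algebras\<close>.
\<close>

record 'a lie =
  lcarrier :: "'a set"
  lscale :: "complex \<Rightarrow> 'a \<Rightarrow> 'a"
  lbracket :: "'a \<Rightarrow> 'a \<Rightarrow> 'a"
  lform :: "'a \<Rightarrow> 'a \<Rightarrow> complex"

locale quadratic_lie_algebra =
  fixes G :: "'a::ab_group_add lie"
  assumes vector_space: "vector_space (lscale G)"
    and subspace: "module.subspace (lscale G) (lcarrier G)"
    and bracket_closed: "\<lbrakk>X \<in> lcarrier G; Y \<in> lcarrier G\<rbrakk> \<Longrightarrow> lbracket G X Y \<in> lcarrier G"
    and bracket_add: "\<lbrakk>X \<in> lcarrier G; Y \<in> lcarrier G; Z \<in> lcarrier G\<rbrakk>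
          \<Longrightarrow> lbracket G (X + Y) Z = lbracket G X Z + lbracket G Y Z"
    and bracket_scale: "\<lbrakk>X \<in> lcarrier G; Y \<in> lcarrier G\<rbrakk>
          \<Longrightarrow> lbracket G (lscale G c X) Y = lscale G c (lbracket G X Y)"
    and bracket_skew: "\<lbrakk>X \<in> lcarrier G; Y \<in> lcarrier G\<rbrakk> \<Longrightarrow> lbracket G X Y = - lbracket G Y X"
    and jacobi: "\<lbrakk>X \<in> lcarrier G; Y \<in> lcarrier G; Z \<in> lcarrier G\<rbrakk>
          \<Longrightarrow> lbracket G X (lbracket G Y Z) + lbracket G Y (lbracket G Z X)
                + lbracket G Z (lbracket G X Y) = 0"
    and form_add: "\<lbrakk>X \<in> lcarrier G; Y \<in> lcarrier G; Z \<in> lcarrier G\<rbrakk>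
          \<Longrightarrow> lform G (X + Y) Z = lform G X Z + lform G Y Z"
    and form_scale: "\<lbrakk>X \<in> lcarrier G; Y \<in> lcarrier G\<rbrakk>
          \<Longrightarrow> lform G (lscale G c X) Y = c * lform G X Y"
    and form_sym: "\<lbrakk>X \<in> lcarrier G; Y \<in> lcarrier G\<rbrakk> \<Longrightarrow> lform G X Y = lform G Y X"
    and form_invariant: "\<lbrakk>X \<in> lcarrier G; Y \<in> lcarrier G; Z \<in> lcarrier G\<rbrakk>
          \<Longrightarrow> lform G (lbracket G X Y) Z = lform G X (lbracket G Y Z)"
    and form_nondegenerate: "\<lbrakk>X \<in> lcarrier G; \<And>Y. Y \<in> lcarrier G \<Longrightarrow> lform G X Y = 0\<rbrakk> \<Longrightarrow> X = 0"

section \<open>Cochains\<close>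

definition tuples :: "'a lie \<Rightarrow> nat \<Rightarrow> 'a list set" where
  "tuples G n = {ys. length ys = n \<and> set ys \<subseteq> lcarrier G}"

text \<open>
  Skew symmetric \<open>n\<close>-linear maps from the Lie algebra to the subspace \<open>W\<close> of a vector space with
  scalar multiplication \<open>s\<close>. A map of \<open>n\<close> arguments is a function on lists; it is required to vanish
  off \<open>tuples G n\<close>, so that two such maps are equal as functions iff they agree on all \<open>n\<close>-tuples and
  the vector space operations are the pointwise ones. For \<open>n = 0\<close> such a map is just its value at
  the empty list, an arbitrary element of \<open>W\<close>.
\<close>

definition skew_maps ::
  "'a::ab_group_add lie \<Rightarrow> (complex \<Rightarrow> 'b::ab_group_add \<Rightarrow> 'b) \<Rightarrow> 'b set \<Rightarrow> nat \<Rightarrow> ('a list \<Rightarrow> 'b) set"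
where
  "skew_maps G s W n = {f.
     (\<forall>ys. ys \<notin> tuples G n \<longrightarrow> f ys = 0) \<and>
     (\<forall>ys \<in> tuples G n. f ys \<in> W) \<and>
     (\<forall>ys \<in> tuples G n. \<forall>i<n. \<forall>x \<in> lcarrier G. \<forall>y \<in> lcarrier G.
        f (ys[i := x + y]) = f (ys[i := x]) + f (ys[i := y])) \<and>
     (\<forall>ys \<in> tuples G n. \<forall>i<n. \<forall>c. \<forall>x \<in> lcarrier G.
        f (ys[i := lscale G c x]) = s c (f (ys[i := x]))) \<and>
     (\<forall>ys \<in> tuples G n. \<forall>i j. i < j \<and> j < n \<longrightarrow>
        f (ys[i := ys ! j, j := ys ! i]) = - f ys)}"

definition forms :: "'a::ab_group_add lie \<Rightarrow> nat \<Rightarrow> ('a list \<Rightarrow> complex) set" where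
  "forms G p = skew_maps G (*) UNIV p"

definition adj_cochains :: "'a::ab_group_add lie \<Rightarrow> nat \<Rightarrow> ('a list \<Rightarrow> 'a) set" where
  "adj_cochains G k = skew_maps G (lscale G) (lcarrier G) k"

text \<open>
  In both differentials \<open>nths ys (- I)\<close> is the list \<open>ys\<close> with the entries at the positions in \<open>I\<close>
  omitted. Positions are counted from 0, so the usual sign \<open>(-1) ^ (i + 1)\<close> of the first sum
  of the Chevalley differential becomes \<open>(-1) ^ i\<close>, while the parity of \<open>i + j\<close> is unchanged. The degree
  of the argument need not be given: it vanishes on lists of any other length.
\<close>

definition form_diff :: "'a::ab_group_add lie \<Rightarrow> ('a list \<Rightarrow> complex) \<Rightarrow> 'a list \<Rightarrow> complex" where
  "form_diff G \<Omega> ys =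
     (if set ys \<subseteq> lcarrier G then
        (\<Sum>j<length ys. \<Sum>i<j. (-1) ^ (i + j) * \<Omega> (lbracket G (ys ! i) (ys ! j) # nths ys (- {i, j})))
      else 0)"

definition adj_diff :: "'a::ab_group_add lie \<Rightarrow> ('a list \<Rightarrow> 'a) \<Rightarrow> 'a list \<Rightarrow> 'a" where
  "adj_diff G C ys =
     (if set ys \<subseteq> lcarrier G then
        (\<Sum>i<length ys. lscale G ((-1) ^ i) (lbracket G (ys ! i) (C (nths ys (- {i})))))
        + (\<Sum>j<length ys. \<Sum>i<j.
             lscale G ((-1) ^ (i + j)) (C (lbracket G (ys ! i) (ys ! j) # nths ys (- {i, j}))))
      else 0)"

definition hat :: "'a::ab_group_add lie \<Rightarrow> ('a list \<Rightarrow> 'a) \<Rightarrow> 'a list \<Rightarrow> complex" where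
  "hat G C ys =
     (if ys \<noteq> [] \<and> set ys \<subseteq> lcarrier G then lform G (C (butlast ys)) (last ys) else 0)"

definition cyclic_cochains :: "'a::ab_group_add lie \<Rightarrow> nat \<Rightarrow> ('a list \<Rightarrow> 'a) set" where
  "cyclic_cochains G k = {C \<in> adj_cochains G k.
     \<forall>ys \<in> tuples G (k + 1). hat G C ys = (-1) ^ k * hat G C (last ys # butlast ys)}"

section \<open>Cohomology\<close>

definition form_cocycles :: "'a::ab_group_add lie \<Rightarrow> nat \<Rightarrow> ('a list \<Rightarrow> complex) set" where
  "form_cocycles G p = {\<Omega> \<in> forms G p. form_diff G \<Omega> = 0}"

definition form_coboundaries :: "'a::ab_group_add lie \<Rightarrow> nat \<Rightarrow> ('a list \<Rightarrow> complex) set" where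
  "form_coboundaries G p = (case p of 0 \<Rightarrow> {0} | Suc q \<Rightarrow> form_diff G ` forms G q)"

definition cyclic_cocycles :: "'a::ab_group_add lie \<Rightarrow> nat \<Rightarrow> ('a list \<Rightarrow> 'a) set" where
  "cyclic_cocycles G k = {C \<in> cyclic_cochains G k. adj_diff G C = 0}"

definition cyclic_coboundaries :: "'a::ab_group_add lie \<Rightarrow> nat \<Rightarrow> ('a list \<Rightarrow> 'a) set" where
  "cyclic_coboundaries G k = (case k of 0 \<Rightarrow> {0} | Suc l \<Rightarrow> adj_diff G ` cyclic_cochains G l)"

definition cong_mod :: "'c::ab_group_add set \<Rightarrow> 'c set \<Rightarrow> ('c \<times> 'c) set" where
  "cong_mod Z N = {(x, y). x \<in> Z \<and> y \<in> Z \<and> x - y \<in> N}"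

definition form_cohomology :: "'a::ab_group_add lie \<Rightarrow> nat \<Rightarrow> ('a list \<Rightarrow> complex) set set" where
  "form_cohomology G p = form_cocycles G p // cong_mod (form_cocycles G p) (form_coboundaries G p)"

definition cyclic_cohomology :: "'a::ab_group_add lie \<Rightarrow> nat \<Rightarrow> ('a list \<Rightarrow> 'a) set set" where
  "cyclic_cohomology G k =
     cyclic_cocycles G k // cong_mod (cyclic_cocycles G k) (cyclic_coboundaries G k)"

text \<open>
  The map induced by \<open>hat\<close> on classes of degree \<open>k\<close>. The union is over representatives of one class;
  all of them contribute the same class, because \<open>hat\<close> is a homomorphism of complexes.
\<close>

definition theta_star ::
  "'a::ab_group_add lie \<Rightarrow> nat \<Rightarrow> ('a list \<Rightarrow> 'a) set \<Rightarrow> ('a list \<Rightarrow> complex) set" where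
  "theta_star G k \<xi> =
     (\<Union>C\<in>\<xi>. cong_mod (form_cocycles G (k + 1)) (form_coboundaries G (k + 1)) `` {hat G C})"

section \<open>Finite rank operators\<close>

definition finite_rank_operators ::
  "(complex \<Rightarrow> 'v::ab_group_add \<Rightarrow> 'v) \<Rightarrow> ('v \<Rightarrow> 'v) set" where
  "finite_rank_operators scale =
     {X. Vector_Spaces.linear scale scale X \<and> (\<exists>S. finite S \<and> range X \<subseteq> module.span scale S)}"

text \<open>
  The sum of the diagonal matrix entries with respect to a basis \<open>S\<close> of the whole space. Only
  finitely many of them are nonzero if \<open>X\<close> has finite rank.
\<close>

definition trace_wrt ::
  "(complex \<Rightarrow> 'v::ab_group_add \<Rightarrow> 'v) \<Rightarrow> 'v set \<Rightarrow> ('v \<Rightarrow> 'v) \<Rightarrow> complex" where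
  "trace_wrt scale S X =
     (\<Sum>b | b \<in> S \<and> module.representation scale S (X b) b \<noteq> 0. module.representation scale S (X b) b)"

text \<open>
  \<open>extend_basis {}\<close> is an arbitrarily chosen basis of the space. The lemma
  \<open>finite_rank_trace_eq\<close> below shows that the choice is irrelevant.
\<close>

definition finite_rank_trace ::
  "(complex \<Rightarrow> 'v::ab_group_add \<Rightarrow> 'v) \<Rightarrow> ('v \<Rightarrow> 'v) \<Rightarrow> complex" where
  "finite_rank_trace scale X = trace_wrt scale (vector_space.extend_basis scale {}) X"

definition finite_rank_lie ::
  "(complex \<Rightarrow> 'v::ab_group_add \<Rightarrow> 'v) \<Rightarrow> ('v \<Rightarrow> 'v) lie" where
  "finite_rank_lie scale =
     \<lparr>lcarrier = finite_rank_operators scale,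
      lscale = (\<lambda>c X v. scale c (X v)),
      lbracket = (\<lambda>X Y. (X \<circ> Y) - (Y \<circ> X)),
      lform = (\<lambda>X Y. finite_rank_trace scale (X \<circ> Y))\<rparr>"

lemma finite_rank_expansion:
  fixes scale :: "complex \<Rightarrow> 'v::ab_group_add \<Rightarrow> 'v"
  assumes "vector_space scale" and X: "X \<in> finite_rank_operators scale"
    and S: "\<not> module.dependent scale S" "module.span scale S = UNIV"
  shows "\<exists>T. finite T \<and> T \<subseteq> S \<and> (\<forall>v b. b \<notin> T \<longrightarrow> module.representation scale S (X v) b = 0)"
proof -
  interpret vector_space scale by fact
  from X obtain R where R: "finite R" "range X \<subseteq> span R"
    by (auto simp: finite_rank_operators_def)
  define T where "T = (\<Union>r\<in>R. {b. representation S r b \<noteq> 0})"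
  have fin: "finite T" using R by (simp add: T_def finite_representation)
  have sub: "T \<subseteq> S" by (auto simp: T_def dest: representation_ne_zero)
  have "span R \<subseteq> {w. \<forall>b. b \<notin> T \<longrightarrow> representation S w b = 0}"
  proof (rule span_minimal)
    show "R \<subseteq> {w. \<forall>b. b \<notin> T \<longrightarrow> representation S w b = 0}" by (auto simp: T_def)
    show "subspace {w. \<forall>b. b \<notin> T \<longrightarrow> representation S w b = 0}"
      by (auto simp: subspace_def representation_zero representation_add representation_scale S)
  qed
  with R have "\<And>v b. b \<notin> T \<Longrightarrow> representation S (X v) b = 0" by blast
  with fin sub show ?thesis by blast
qed

lemma trace_wrt_superset:
  assumes "finite T" "T \<subseteq> S" "\<And>v b. b \<notin> T \<Longrightarrow> module.representation scale S (X v) b = 0"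
  shows "trace_wrt scale S X = (\<Sum>b\<in>T. module.representation scale S (X b) b)"
  unfolding trace_wrt_def using assms by (intro sum.mono_neutral_left) auto

lemma representation_sum_superset:
  fixes scale :: "complex \<Rightarrow> 'v::ab_group_add \<Rightarrow> 'v"
  assumes "vector_space scale" "\<not> module.dependent scale S" "module.span scale S = UNIV" "finite T"
    "\<And>b. b \<notin> T \<Longrightarrow> module.representation scale S v b = 0"
  shows "(\<Sum>b\<in>T. scale (module.representation scale S v b) b) = v"
proof -
  interpret vector_space scale by fact
  have "(\<Sum>b\<in>T. scale (representation S v b) b) = (\<Sum>b | representation S v b \<noteq> 0. scale (representation S v b) b)"
    using assms by (intro sum.mono_neutral_right) auto
  also have "\<dots> = v" using assms by (intro sum_nonzero_representation_eq) auto
  finally show ?thesis .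
qed

lemma trace_wrt_eq:
  fixes scale :: "complex \<Rightarrow> 'v::ab_group_add \<Rightarrow> 'v"
  assumes V: "vector_space scale" and X: "X \<in> finite_rank_operators scale"
    and S: "\<not> module.dependent scale S" "module.span scale S = UNIV"
    and S': "\<not> module.dependent scale S'" "module.span scale S' = UNIV"
  shows "trace_wrt scale S' X = trace_wrt scale S X"
proof -
  interpret vector_space scale by fact
  interpret X: Vector_Spaces.linear scale scale X
    using X by (simp add: finite_rank_operators_def)
  obtain T where T: "finite T" "T \<subseteq> S" "\<And>v b. b \<notin> T \<Longrightarrow> representation S (X v) b = 0"
    using finite_rank_expansion[OF V X S] by blast
  obtain T' where T': "finite T'" "T' \<subseteq> S'" "\<And>v b. b \<notin> T' \<Longrightarrow> representation S' (X v) b = 0"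
    using finite_rank_expansion[OF V X S'] by blast
  define U where "U = T' \<union> (\<Union>c\<in>T. {b. representation S' c b \<noteq> 0})"
  have U: "finite U" using T T' by (simp add: U_def finite_representation)
  have US: "U \<subseteq> S'" using T' by (auto simp: U_def dest: representation_ne_zero)
  have rep: "representation S' (X v) b = (\<Sum>c\<in>T. representation S (X v) c * representation S' c b)" for v b
  proof -
    have "representation S' (X v) b = representation S' (\<Sum>c\<in>T. scale (representation S (X v) c) c) b"
      using representation_sum_superset[OF V S T(1)] T(3) by simp
    also have "\<dots> = (\<Sum>c\<in>T. representation S (X v) c * representation S' c b)"
      using S' by (simp add: representation_sum representation_scale)
    finally show ?thesis .
  qed
  have rs: "representation S (X c) c = (\<Sum>b\<in>U. representation S' c b * representation S (X b) c)" if "c \<in> T" for c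
  proof -
    have "c = (\<Sum>b\<in>U. scale (representation S' c b) b)"
      using that by (intro representation_sum_superset[OF V S' U, symmetric]) (auto simp: U_def)
    then have "X c = (\<Sum>b\<in>U. scale (representation S' c b) (X b))"
      by (metis (no_types, lifting) X.scale X.sum sum.cong)
    then show ?thesis using S by (simp add: representation_sum representation_scale)
  qed
  have "trace_wrt scale S' X = (\<Sum>b\<in>U. representation S' (X b) b)"
    by (intro trace_wrt_superset[OF U US]) (auto simp: U_def T')
  also have "\<dots> = (\<Sum>b\<in>U. \<Sum>c\<in>T. representation S (X b) c * representation S' c b)"
    by (simp add: rep)
  also have "\<dots> = (\<Sum>c\<in>T. \<Sum>b\<in>U. representation S' c b * representation S (X b) c)"
    by (subst sum.swap) (simp add: mult.commute)
  also have "\<dots> = (\<Sum>c\<in>T. representation S (X c) c)" by (simp add: rs)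
  also have "\<dots> = trace_wrt scale S X" using trace_wrt_superset[OF T] by simp
  finally show ?thesis .
qed

lemma finite_rank_trace_eq:
  fixes scale :: "complex \<Rightarrow> 'v::ab_group_add \<Rightarrow> 'v"
  assumes V: "vector_space scale" and X: "X \<in> finite_rank_operators scale"
    and S: "\<not> module.dependent scale S" "module.span scale S = UNIV"
  shows "finite_rank_trace scale X = trace_wrt scale S X"
proof -
  interpret vector_space scale by fact
  show ?thesis unfolding finite_rank_trace_def
    by (rule trace_wrt_eq[OF V X S])
      (simp_all add: independent_extend_basis independent_empty)
qed

lemma finite_rank_trace_commute:
  fixes scale :: "complex \<Rightarrow> 'v::ab_group_add \<Rightarrow> 'v"
  assumes V: "vector_space scale"
    and X: "X \<in> finite_rank_operators scale" and Y: "Y \<in> finite_rank_operators scale"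
  shows "finite_rank_trace scale (X \<circ> Y) = finite_rank_trace scale (Y \<circ> X)"
proof -
  interpret vector_space scale by fact
  define S where "S = extend_basis {}"
  have S: "independent S" "span S = UNIV"
    by (simp_all add: S_def independent_extend_basis independent_empty)
  obtain T where T: "finite T" "T \<subseteq> S" "\<And>v b. b \<notin> T \<Longrightarrow> representation S (X v) b = 0"
    using finite_rank_expansion[OF V X S] by blast
  obtain T' where T': "finite T'" "T' \<subseteq> S" "\<And>v b. b \<notin> T' \<Longrightarrow> representation S (Y v) b = 0"
    using finite_rank_expansion[OF V Y S] by blast
  define U where "U = T \<union> T'"
  have U: "finite U" "U \<subseteq> S" using T T' by (auto simp: U_def)
  have *: "trace_wrt scale S (A \<circ> B) = (\<Sum>b\<in>U. \<Sum>c\<in>U. representation S (B b) c * representation S (A c) b)"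
    if A: "Vector_Spaces.linear scale scale A" "\<And>v b. b \<notin> U \<Longrightarrow> representation S (A v) b = 0"
      and B: "\<And>v b. b \<notin> U \<Longrightarrow> representation S (B v) b = 0" for A B
  proof -
    interpret A: Vector_Spaces.linear scale scale A by fact
    have "A (B b) = (\<Sum>c\<in>U. scale (representation S (B b) c) (A c))" for b
    proof -
      have "A (B b) = A (\<Sum>c\<in>U. scale (representation S (B b) c) c)"
        using representation_sum_superset[OF V S U(1)] B by simp
      then show ?thesis by (simp add: A.sum A.scale)
    qed
    then have "representation S (A (B b)) b = (\<Sum>c\<in>U. representation S (B b) c * representation S (A c) b)" for b
      using S by (simp add: representation_sum representation_scale)
    then show ?thesis using trace_wrt_superset[OF U, of scale "A \<circ> B"] A by simp
  qed
  have "trace_wrt scale S (X \<circ> Y) = trace_wrt scale S (Y \<circ> X)"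
    using X Y T T'
    apply (subst (1 2) *)
    apply (auto simp: U_def finite_rank_operators_def)
    apply (subst sum.swap)
    apply (simp add: mult.commute)
    done
  then show ?thesis by (simp add: finite_rank_trace_def S_def)
qed

lemma finite_rank_zero:
  fixes scale :: "complex \<Rightarrow> 'v::ab_group_add \<Rightarrow> 'v"
  assumes V: "vector_space scale"
  shows "0 \<in> finite_rank_operators scale"
proof -
  interpret vector_space scale by fact
  interpret p: vector_space_pair scale scale by unfold_locales
  have "Vector_Spaces.linear scale scale 0" by (simp add: zero_fun_def p.linear_zero)
  moreover have "range (0 :: 'v \<Rightarrow> 'v) \<subseteq> span {}" by auto
  ultimately show ?thesis unfolding finite_rank_operators_def by blast
qed

lemma finite_rank_add:
  fixes scale :: "complex \<Rightarrow> 'v::ab_group_add \<Rightarrow> 'v"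
  assumes V: "vector_space scale" and X: "X \<in> finite_rank_operators scale" and Y: "Y \<in> finite_rank_operators scale"
  shows "X + Y \<in> finite_rank_operators scale"
proof -
  interpret vector_space scale by fact
  interpret p: vector_space_pair scale scale by unfold_locales
  from X obtain S where S: "finite S" "range X \<subseteq> span S" by (auto simp: finite_rank_operators_def)
  from Y obtain R where R: "finite R" "range Y \<subseteq> span R" by (auto simp: finite_rank_operators_def)
  have "range X \<subseteq> span (S \<union> R)" "range Y \<subseteq> span (S \<union> R)"
    using S(2) R(2) span_mono[OF Un_upper1[of S R]] span_mono[OF Un_upper2[of R S]]
    by blast+
  then have "X v + Y v \<in> span (S \<union> R)" for v by (intro span_add) (blast+)
  then have "range (X + Y) \<subseteq> span (S \<union> R)" by (simp add: image_subset_iff)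
  moreover have "Vector_Spaces.linear scale scale (X + Y)"
    using X Y p.linear_compose_add[of X Y] by (simp add: finite_rank_operators_def plus_fun_def)
  moreover have "finite (S \<union> R)" using S R by simp
  ultimately show ?thesis unfolding finite_rank_operators_def by blast
qed

lemma finite_rank_scale:
  fixes scale :: "complex \<Rightarrow> 'v::ab_group_add \<Rightarrow> 'v"
  assumes V: "vector_space scale" and X: "X \<in> finite_rank_operators scale"
  shows "(\<lambda>v. scale c (X v)) \<in> finite_rank_operators scale"
proof -
  interpret vector_space scale by fact
  interpret p: vector_space_pair scale scale by unfold_locales
  from X obtain S where S: "finite S" "range X \<subseteq> span S" by (auto simp: finite_rank_operators_def)
  then have "range (\<lambda>v. scale c (X v)) \<subseteq> span S" by (auto intro: span_scale)
  moreover have "Vector_Spaces.linear scale scale (\<lambda>v. scale c (X v))"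
    using X p.linear_compose_scale_right[of X c] by (simp add: finite_rank_operators_def)
  ultimately show ?thesis using S(1) unfolding finite_rank_operators_def by blast
qed

lemma finite_rank_comp:
  fixes scale :: "complex \<Rightarrow> 'v::ab_group_add \<Rightarrow> 'v"
  assumes V: "vector_space scale" and X: "X \<in> finite_rank_operators scale" and Y: "Y \<in> finite_rank_operators scale"
  shows "X \<circ> Y \<in> finite_rank_operators scale"
proof -
  interpret vector_space scale by fact
  from X obtain S where S: "finite S" "range X \<subseteq> span S" by (auto simp: finite_rank_operators_def)
  then have "range (X \<circ> Y) \<subseteq> span S" by auto
  moreover have "Vector_Spaces.linear scale scale (X \<circ> Y)"
    using X Y Vector_Spaces.linear_compose[of scale scale Y scale X]
    by (simp add: finite_rank_operators_def)
  ultimately show ?thesis using S(1) unfolding finite_rank_operators_def by blast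
qed

lemma finite_rank_diff:
  fixes scale :: "complex \<Rightarrow> 'v::ab_group_add \<Rightarrow> 'v"
  assumes V: "vector_space scale" and X: "X \<in> finite_rank_operators scale" and Y: "Y \<in> finite_rank_operators scale"
  shows "X - Y \<in> finite_rank_operators scale"
proof -
  interpret vector_space scale by fact
  have "X - Y = X + (\<lambda>v. scale (- 1) (Y v))" by (rule ext) simp
  also have "\<dots> \<in> finite_rank_operators scale"
    using finite_rank_add[OF V X finite_rank_scale[OF V Y]] .
  finally show ?thesis .
qed

lemmas finite_rank_operators_closed =
  finite_rank_zero finite_rank_add finite_rank_scale finite_rank_comp finite_rank_diff

lemma finite_rank_trace_add:
  fixes scale :: "complex \<Rightarrow> 'v::ab_group_add \<Rightarrow> 'v"
  assumes V: "vector_space scale"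
    and X: "X \<in> finite_rank_operators scale" and Y: "Y \<in> finite_rank_operators scale"
  shows "finite_rank_trace scale (X + Y) = finite_rank_trace scale X + finite_rank_trace scale Y"
proof -
  interpret vector_space scale by fact
  define S where "S = extend_basis {}"
  have S: "independent S" "span S = UNIV"
    by (simp_all add: S_def independent_extend_basis independent_empty)
  obtain T where T: "finite T" "T \<subseteq> S" "\<And>v b. b \<notin> T \<Longrightarrow> representation S (X v) b = 0"
    using finite_rank_expansion[OF V X S] by blast
  obtain T' where T': "finite T'" "T' \<subseteq> S" "\<And>v b. b \<notin> T' \<Longrightarrow> representation S (Y v) b = 0"
    using finite_rank_expansion[OF V Y S] by blast
  define U where "U = T \<union> T'"
  have U: "finite U" "U \<subseteq> S" using T T' by (auto simp: U_def)
  have "trace_wrt scale S X = (\<Sum>b\<in>U. representation S (X b) b)"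
    "trace_wrt scale S Y = (\<Sum>b\<in>U. representation S (Y b) b)"
    using trace_wrt_superset[OF U, of scale X] trace_wrt_superset[OF U, of scale Y] T(3) T'(3)
    by (simp_all add: U_def)
  moreover have "trace_wrt scale S (X + Y) = (\<Sum>b\<in>U. representation S ((X + Y) b) b)"
    by (rule trace_wrt_superset[OF U]) (simp add: U_def T(3) T'(3) S representation_add)
  ultimately show ?thesis
    by (simp add: finite_rank_trace_def S_def[symmetric] S representation_add sum.distrib)
qed

lemma finite_rank_trace_scale:
  fixes scale :: "complex \<Rightarrow> 'v::ab_group_add \<Rightarrow> 'v"
  assumes V: "vector_space scale" and X: "X \<in> finite_rank_operators scale"
  shows "finite_rank_trace scale (\<lambda>v. scale c (X v)) = c * finite_rank_trace scale X"
proof -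
  interpret vector_space scale by fact
  define S where "S = extend_basis {}"
  have S: "independent S" "span S = UNIV"
    by (simp_all add: S_def independent_extend_basis independent_empty)
  obtain T where T: "finite T" "T \<subseteq> S" "\<And>v b. b \<notin> T \<Longrightarrow> representation S (X v) b = 0"
    using finite_rank_expansion[OF V X S] by blast
  have "trace_wrt scale S X = (\<Sum>b\<in>T. representation S (X b) b)"
    by (rule trace_wrt_superset[OF T])
  moreover have "trace_wrt scale S (\<lambda>v. scale c (X v)) = (\<Sum>b\<in>T. representation S (scale c (X b)) b)"
    by (rule trace_wrt_superset[OF T(1,2)]) (simp add: T(3) S representation_scale)
  ultimately show ?thesis
    by (simp add: finite_rank_trace_def S_def[symmetric] S representation_scale sum_distrib_left)
qed

text \<open>\<open>\<phi>\<close> is the coordinate functional of \<open>w\<close> with respect to a basis containing \<open>w\<close>.\<close>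

lemma rank_one_witness:
  fixes scale :: "complex \<Rightarrow> 'v::ab_group_add \<Rightarrow> 'v"
  assumes V: "vector_space scale" and w: "w \<noteq> 0"
  shows "\<exists>\<phi>. Vector_Spaces.linear scale (*) \<phi> \<and> \<phi> w = 1 \<and>
    (\<forall>v. (\<lambda>x. scale (\<phi> x) v) \<in> finite_rank_operators scale \<and>
         finite_rank_trace scale (\<lambda>x. scale (\<phi> x) v) = \<phi> v)"
proof -
  interpret vector_space scale by fact
  define S where "S = extend_basis {w}"
  have iw: "independent {w}" using w by (simp add: dependent_single)
  have S: "independent S" "span S = UNIV" "w \<in> S"
    using extend_basis_superset[OF iw] independent_extend_basis[OF iw] span_extend_basis[OF iw]
    by (auto simp: S_def)
  define \<phi> where "\<phi> x = representation S x w" for x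
  have lin: "Vector_Spaces.linear scale (*) \<phi>"
    unfolding \<phi>_def using S by (intro linear_representation) auto
  have mem: "(\<lambda>x. scale (\<phi> x) v) \<in> finite_rank_operators scale" for v
  proof -
    have "Vector_Spaces.linear scale scale (\<lambda>x. scale (\<phi> x) v)"
      unfolding \<phi>_def using S
      by unfold_locales (auto simp: representation_add representation_scale scale_left_distrib)
    moreover have "range (\<lambda>x. scale (\<phi> x) v) \<subseteq> span {v}"
      by (auto intro: span_scale span_base)
    ultimately show ?thesis unfolding finite_rank_operators_def by blast
  qed
  have "finite_rank_trace scale (\<lambda>x. scale (\<phi> x) v) = \<phi> v" for v
  proof -
    have "finite_rank_trace scale (\<lambda>x. scale (\<phi> x) v) = trace_wrt scale S (\<lambda>x. scale (\<phi> x) v)"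
      using finite_rank_trace_eq[OF V mem S(1,2)] .
    also have "\<dots> = (\<Sum>b | b \<in> S \<and> \<phi> b * representation S v b \<noteq> 0. \<phi> b * representation S v b)"
      using S by (simp add: trace_wrt_def representation_scale)
    also have "\<dots> = (\<Sum>b\<in>{w}. \<phi> b * representation S v b)"
      using S by (intro sum.mono_neutral_left) (auto simp: \<phi>_def representation_basis split: if_splits)
    also have "\<dots> = \<phi> v" using S by (simp add: \<phi>_def representation_basis)
    finally show ?thesis .
  qed
  moreover have "\<phi> w = 1" using S by (simp add: \<phi>_def representation_basis)
  ultimately show ?thesis using lin mem by blast
qed

theorem quadratic_lie_algebra_finite_rank:
  fixes scale :: "complex \<Rightarrow> 'v::ab_group_add \<Rightarrow> 'v"
  assumes V: "vector_space scale"
  shows "quadratic_lie_algebra (finite_rank_lie scale)"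
proof -
  interpret vector_space scale by fact
  let ?sc = "\<lambda>c (X :: 'v \<Rightarrow> 'v) v. scale c (X v)"
  let ?F = "finite_rank_operators scale"
  note cl = finite_rank_operators_closed[OF V]
  note ad = finite_rank_trace_add[OF V]
  note sc = finite_rank_trace_scale[OF V]
  have vs: "vector_space ?sc"
    by unfold_locales (auto simp: fun_eq_iff scale_right_distrib scale_left_distrib)
  interpret O: vector_space ?sc by (fact vs)
  have lin: "X (u + v) = X u + X v" "X (u - v) = X u - X v" "X (scale c v) = scale c (X v)" "X 0 = 0"
     if "X \<in> ?F" for X u v c
  proof -
    interpret X: Vector_Spaces.linear scale scale X using that by (simp add: finite_rank_operators_def)
    show "X (u + v) = X u + X v" "X (u - v) = X u - X v" "X (scale c v) = scale c (X v)" "X 0 = 0"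
      by (simp_all add: X.add X.diff X.scale X.zero)
  qed
  have diff: "finite_rank_trace scale (X - Y) = finite_rank_trace scale X - finite_rank_trace scale Y"
    if "X \<in> ?F" "Y \<in> ?F" for X Y
    using ad[OF cl(5)[OF that] that(2)] by simp
  show ?thesis
  proof (rule quadratic_lie_algebra.intro, unfold finite_rank_lie_def lie.simps)
    show "vector_space ?sc" by (fact vs)
    show "O.subspace ?F" unfolding O.subspace_def using cl by blast
  next
    fix X Y assume F: "X \<in> ?F" "Y \<in> ?F"
    then show "(X \<circ> Y) - (Y \<circ> X) \<in> ?F" by (simp add: cl(4,5))
  next
    fix X Y Z assume F: "X \<in> ?F" "Y \<in> ?F" "Z \<in> ?F"
    then show "((X + Y) \<circ> Z) - (Z \<circ> (X + Y)) = (X \<circ> Z) - (Z \<circ> X) + ((Y \<circ> Z) - (Z \<circ> Y))"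
      by (auto simp: fun_eq_iff lin[OF F(1)] lin[OF F(2)] lin[OF F(3)])
  next
    fix X Y c assume F: "X \<in> ?F" "Y \<in> ?F"
    then show "(?sc c X \<circ> Y) - (Y \<circ> ?sc c X) = ?sc c ((X \<circ> Y) - (Y \<circ> X))"
      by (auto simp: fun_eq_iff lin[OF F(1)] lin[OF F(2)] scale_right_diff_distrib)
  next
    fix X Y :: "'v \<Rightarrow> 'v"
    show "(X \<circ> Y) - (Y \<circ> X) = - ((Y \<circ> X) - (X \<circ> Y))" by simp
  next
    fix X Y Z assume F: "X \<in> ?F" "Y \<in> ?F" "Z \<in> ?F"
    then show "((X \<circ> ((Y \<circ> Z) - (Z \<circ> Y))) - (((Y \<circ> Z) - (Z \<circ> Y)) \<circ> X))
      + ((Y \<circ> ((Z \<circ> X) - (X \<circ> Z))) - (((Z \<circ> X) - (X \<circ> Z)) \<circ> Y))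
      + ((Z \<circ> ((X \<circ> Y) - (Y \<circ> X))) - (((X \<circ> Y) - (Y \<circ> X)) \<circ> Z)) = 0"
      by (auto simp: fun_eq_iff lin[OF F(1)] lin[OF F(2)] lin[OF F(3)])
  next
    fix X Y Z assume F: "X \<in> ?F" "Y \<in> ?F" "Z \<in> ?F"
    have "(X + Y) \<circ> Z = (X \<circ> Z) + (Y \<circ> Z)" by (auto simp: fun_eq_iff)
    then show "finite_rank_trace scale ((X + Y) \<circ> Z) = finite_rank_trace scale (X \<circ> Z) + finite_rank_trace scale (Y \<circ> Z)"
      using F by (simp add: ad cl)
  next
    fix X Y c assume F: "X \<in> ?F" "Y \<in> ?F"
    have "?sc c X \<circ> Y = ?sc c (X \<circ> Y)" by (auto simp: fun_eq_iff)
    then show "finite_rank_trace scale (?sc c X \<circ> Y) = c * finite_rank_trace scale (X \<circ> Y)"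
      using F by (simp only: sc cl)
  next
    fix X Y assume F: "X \<in> ?F" "Y \<in> ?F"
    then show "finite_rank_trace scale (X \<circ> Y) = finite_rank_trace scale (Y \<circ> X)"
      by (rule finite_rank_trace_commute[OF V])
  next
    fix X Y Z assume F: "X \<in> ?F" "Y \<in> ?F" "Z \<in> ?F"
    have 1: "((X \<circ> Y) - (Y \<circ> X)) \<circ> Z = (X \<circ> Y \<circ> Z) - (Y \<circ> (X \<circ> Z))" by (auto simp: fun_eq_iff)
    have 2: "X \<circ> ((Y \<circ> Z) - (Z \<circ> Y)) = (X \<circ> Y \<circ> Z) - (X \<circ> Z \<circ> Y)" using F by (auto simp: fun_eq_iff lin[OF F(1)] lin[OF F(2)] lin[OF F(3)])
    show "finite_rank_trace scale (((X \<circ> Y) - (Y \<circ> X)) \<circ> Z) = finite_rank_trace scale (X \<circ> ((Y \<circ> Z) - (Z \<circ> Y)))"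
      unfolding 1 2 using F finite_rank_trace_commute[OF V, of Y "X \<circ> Z"] by (simp add: diff cl)
  next
    fix X assume F: "X \<in> ?F" and 0: "\<And>Y. Y \<in> ?F \<Longrightarrow> finite_rank_trace scale (X \<circ> Y) = 0"
    show "X = 0"
    proof (rule ccontr)
      assume "X \<noteq> 0"
      then obtain v where "X v \<noteq> 0" by (auto simp: fun_eq_iff)
      with rank_one_witness[OF V this] obtain \<phi> where \<phi>: "\<phi> (X v) = 1"
        "\<And>v. (\<lambda>x. scale (\<phi> x) v) \<in> ?F" "\<And>v. finite_rank_trace scale (\<lambda>x. scale (\<phi> x) v) = \<phi> v"
        by blast
      have "X \<circ> (\<lambda>x. scale (\<phi> x) v) = (\<lambda>x. scale (\<phi> x) (X v))" using F by (auto simp: lin[OF F])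
      with 0[OF \<phi>(2)[of v]] \<phi> show False by simp
    qed
  qed
qed

end

theory Submission
  imports Defs
begin

text \<open>
  The trace is a 1-cocycle, since it vanishes on commutators, and no nonzero 1-form is a coboundary.
  A cyclic 0-cochain is an operator \<open>A\<close>, and it is mapped to the form \<open>Tr (A X)\<close>. If this were the trace,
  testing with rank one operators would give \<open>A = id\<close>, which has infinite rank.
\<close>

text \<open>Every term of the differential evaluates \<open>\<Omega>\<close> on a nonempty list,
  where a 0-form has its default value 0.\<close>

lemma form_diff_zero_form:
  assumes "\<Omega> \<in> forms G 0"
  shows "form_diff G \<Omega> = 0"
proof -
  have "\<Omega> (x # xs) = 0" for x xs
    using assms by (auto simp: forms_def skew_maps_def tuples_def)
  then show ?thesis by (auto simp: form_diff_def fun_eq_iff)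
qed

lemma form_coboundaries_1_subset: "form_coboundaries G 1 \<subseteq> {0}"
  by (auto simp: form_coboundaries_def form_diff_zero_form)

text \<open>Finite rank will yield a finite spanning set, while infinite dimension is stated as the
  absence of a finite basis. A maximal independent subset of \<open>R\<close> bridges the
  two.\<close>

lemma vector_space_finite_spanning_set:
  assumes "vector_space scale" "finite R" "module.span scale R = UNIV"
  shows "\<exists>S. finite_dimensional_vector_space scale S"
proof -
  interpret vector_space scale by fact
  obtain S where S: "S \<subseteq> R" "independent S" "R \<subseteq> span S"
    by (rule maximal_independent_subset)
  then have "span S = UNIV"
    using assms(3) span_minimal[of R "span S"] by auto
  moreover have "finite S" using S assms(2) finite_subset by blast
  ultimately have "finite_dimensional_vector_space scale S"
    using S by unfold_locales auto
  then show ?thesis ..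
qed

text \<open>If \<open>A v\<close> differs from \<open>v\<close>, some functional
  \<open>\<phi>\<close> has \<open>\<phi> (v - A v) = 1\<close>. The rank one operator sending
  \<open>x\<close> to \<open>\<phi> x\<close> times \<open>v\<close> has trace
  \<open>\<phi> v\<close>, and composing it with \<open>A\<close> gives trace
  \<open>\<phi> (A v)\<close>, so equal traces contradict the choice of
  \<open>\<phi>\<close>.\<close>

lemma trace_represented_imp_id:
  fixes scale :: "complex \<Rightarrow> 'v::ab_group_add \<Rightarrow> 'v"
  assumes V: "vector_space scale" and A: "Vector_Spaces.linear scale scale A"
    and eq: "\<And>X. X \<in> finite_rank_operators scale \<Longrightarrow>
      finite_rank_trace scale (A \<circ> X) = finite_rank_trace scale X"
  shows "A v = v"
proof (rule ccontr)
  interpret A: Vector_Spaces.linear scale scale A by fact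
  assume "A v \<noteq> v"
  then have "v - A v \<noteq> 0" by simp
  from rank_one_witness[OF V this] obtain \<phi> where
    lin: "Vector_Spaces.linear scale (*) \<phi>" and 1: "\<phi> (v - A v) = 1"
    and F: "\<And>u. (\<lambda>x. scale (\<phi> x) u) \<in> finite_rank_operators scale"
    and tr: "\<And>u. finite_rank_trace scale (\<lambda>x. scale (\<phi> x) u) = \<phi> u" by blast
  interpret \<phi>: Vector_Spaces.linear scale "(*)" \<phi> by fact
  have "A \<circ> (\<lambda>x. scale (\<phi> x) v) = (\<lambda>x. scale (\<phi> x) (A v))"
    by (simp add: fun_eq_iff A.scale)
  with eq[OF F[of v]] tr have "\<phi> (A v) = \<phi> v" by simp
  with 1 show False by (simp add: \<phi>.diff)
qed

text \<open>The guard gives the value 0 off 1-tuples, as membership in \<open>forms\<close>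
  demands.\<close>

definition trace_form :: "(complex \<Rightarrow> 'v::ab_group_add \<Rightarrow> 'v) \<Rightarrow> ('v \<Rightarrow> 'v) list \<Rightarrow> complex" where
  "trace_form scale ys =
    (if ys \<in> tuples (finite_rank_lie scale) 1 then finite_rank_trace scale (hd ys) else 0)"

lemma trace_form_singleton:
  "X \<in> finite_rank_operators scale \<Longrightarrow> trace_form scale [X] = finite_rank_trace scale X"
  by (simp add: trace_form_def tuples_def finite_rank_lie_def)

lemma trace_form_cocycle:
  fixes scale :: "complex \<Rightarrow> 'v::ab_group_add \<Rightarrow> 'v"
  assumes V: "vector_space scale"
  shows "trace_form scale \<in> form_cocycles (finite_rank_lie scale) 1"
proof -
  let ?G = "finite_rank_lie scale" and ?F = "finite_rank_operators scale"
  note cl = finite_rank_operators_closed[OF V]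
  have car: "lcarrier ?G = ?F" by (simp add: finite_rank_lie_def)
  have sc: "lscale ?G c X = (\<lambda>v. scale c (X v))" for c X by (simp add: finite_rank_lie_def)
  have upd: "ys[0 := X] = [X]" if "ys \<in> tuples ?G (Suc 0)" for ys X
    using that by (auto simp: tuples_def length_Suc_conv)
  have off: "trace_form scale ys = 0" if "ys \<notin> tuples ?G (Suc 0)" for ys
    using that by (simp add: trace_form_def)
  \<comment> \<open>Skew symmetry is vacuous in degree 1, since no \<open>i < j\<close> has
    \<open>j < 1\<close>.\<close>
  have "trace_form scale \<in> forms ?G 1"
    unfolding forms_def skew_maps_def
    by (simp add: car sc off upd trace_form_singleton cl finite_rank_trace_add[OF V]
        finite_rank_trace_scale[OF V])
  moreover have "form_diff ?G (trace_form scale) ys = 0" for ys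
  proof (cases "set ys \<subseteq> ?F \<and> length ys = 2")
    case True
    then obtain X Y where ys: "ys = [X, Y]" "X \<in> ?F" "Y \<in> ?F"
      by (auto simp: length_Suc_conv numeral_2_eq_2)
    \<comment> \<open>Additivity is applied to the sum of the commutator and
      \<open>Y \<circ> X\<close>, which is \<open>X \<circ> Y\<close>.\<close>
    have "finite_rank_trace scale ((X \<circ> Y) - (Y \<circ> X))
        = finite_rank_trace scale (X \<circ> Y) - finite_rank_trace scale (Y \<circ> X)"
      using finite_rank_trace_add[OF V, of "(X \<circ> Y) - (Y \<circ> X)" "Y \<circ> X"] ys cl(4,5) by simp
    also have "\<dots> = 0" using ys by (simp add: finite_rank_trace_commute[OF V])
    finally have "trace_form scale [lbracket ?G X Y] = 0"
      using ys cl(4,5) by (simp add: trace_form_singleton finite_rank_lie_def)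
    then show ?thesis
      by (simp add: form_diff_def ys numeral_2_eq_2 nths_Cons)
  next
    case False
    \<comment> \<open>Dropping two entries and adding \<open>Z\<close> leaves length
      \<open>length ys - 1\<close>, which is not 1 here, so the default value 0 applies.\<close>
    have "trace_form scale (Z # nths ys (- {i, j})) = 0" if "set ys \<subseteq> ?F" "i < j" "j < length ys" for Z i j
    proof -
      have "{k. k < length ys \<and> k \<in> - {i, j}} = {..<length ys} - {i, j}" by auto
      then have "length (nths ys (- {i, j})) = length ys - 2"
        using that by (simp add: length_nths card_Diff_subset)
      then show ?thesis using False that by (simp add: trace_form_def tuples_def)
    qed
    then show ?thesis by (simp add: form_diff_def car)
  qed
  ultimately show ?thesis by (simp add: form_cocycles_def fun_eq_iff)
qed

theorem proposition7p4p10: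
  fixes scale :: "complex \<Rightarrow> 'v::ab_group_add \<Rightarrow> 'v"
  assumes "vector_space scale"
    and "\<nexists>S. finite_dimensional_vector_space scale S"
  shows "\<not> form_cohomology (finite_rank_lie scale) 1
           \<subseteq> theta_star (finite_rank_lie scale) 0 ` cyclic_cohomology (finite_rank_lie scale) 0"
proof
  let ?G = "finite_rank_lie scale" and ?F = "finite_rank_operators scale" and ?T = "trace_form scale"
  let ?R = "cong_mod (form_cocycles ?G 1) (form_coboundaries ?G 1)"
  assume sub: "form_cohomology ?G 1 \<subseteq> theta_star ?G 0 ` cyclic_cohomology ?G 0"
  interpret vector_space scale by fact
  note T = trace_form_cocycle[OF assms(1)]
  have "?R `` {?T} \<in> form_cohomology ?G 1"
    unfolding form_cohomology_def by (rule quotientI) (rule T)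
  with sub obtain \<xi> where \<xi>: "\<xi> \<in> cyclic_cohomology ?G 0" "?R `` {?T} = theta_star ?G 0 \<xi>"
    by blast
  \<comment> \<open>That 0 is a coboundary makes \<open>?R\<close> reflexive at \<open>?T\<close>,
    which puts \<open>?T\<close> into its own class.\<close>
  have "0 \<in> forms ?G 0" by (simp add: forms_def skew_maps_def)
  then have "0 \<in> form_coboundaries ?G 1"
    using form_diff_zero_form[of 0 ?G] by (force simp: form_coboundaries_def)
  with T have "?T \<in> ?R `` {?T}" by (simp add: cong_mod_def)
  \<comment> \<open>\<open>theta_star\<close> is a union over representatives, so a single
    \<open>C\<close> already contributes \<open>?T\<close>.\<close>
  then obtain C where C: "C \<in> \<xi>" "(hat ?G C, ?T) \<in> ?R"
    using \<xi>(2) by (auto simp: theta_star_def)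
  \<comment> \<open>In degree 1 only 0 is a coboundary, so cohomologous forms are equal.\<close>
  have hat: "hat ?G C = ?T"
    using C(2) form_coboundaries_1_subset[of ?G] by (auto simp: cong_mod_def)
  have "C \<in> cyclic_cocycles ?G 0"
    using \<xi>(1) C(1) by (auto simp: cyclic_cohomology_def quotient_def cong_mod_def)
  \<comment> \<open>The only 0-tuple is the empty list, so the cochain \<open>C\<close> amounts to
    the operator \<open>C []\<close>.\<close>
  then have A: "C [] \<in> ?F"
    by (simp add: cyclic_cocycles_def cyclic_cochains_def adj_cochains_def skew_maps_def
        tuples_def finite_rank_lie_def)
  have "finite_rank_trace scale (C [] \<circ> X) = finite_rank_trace scale X" if "X \<in> ?F" for X
    using fun_cong[OF hat, of "[X]"] that
    by (simp add: trace_form_singleton) (simp add: hat_def finite_rank_lie_def)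
  with A have "C [] v = v" for v
    using trace_represented_imp_id[OF assms(1)] by (auto simp: finite_rank_operators_def)
  \<comment> \<open>Since \<open>C []\<close> has finite rank, a finite set spanning its range now
    spans the whole space.\<close>
  then have "range (C []) = UNIV" by auto
  with A obtain S where "finite S" "span S = UNIV"
    by (auto simp: finite_rank_operators_def)
  with vector_space_finite_spanning_set[OF assms(1)] assms(2) show False by blast
qed

end
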